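(* Let $M$ be a finite set, let $(\lambda,\mathcal{L})$ be a ranked lattice of subsets of $M$ and let $\mu$ be a measure on $M$. Then the following are equivalent. (i) There is a polymatroid $(f,M)$ on the ground set $M$ such that $\mathcal{L}$ is exactly the collection of cyclic flats of $(f,M)$, $\lambda(Z)=f(Z)$ for every $Z\in\mathcal{L}$, and $\mu(\{a\})=f(\{a\})$ for every $a\in M$. (ii) All of the following conditions hold: - $\lambda(O_{\mathcal{L}})=0$; - for all $Z_1,Z_2\in\mathcal{L}$ with $Z_1\subsetneq Z_2$: $0<\lambda(Z_2)-\lambda(Z_1)<\mu(Z_2\setminus Z_1)$; - for all $Z_1,Z_2\in\mathcal{L}$: $\lambda(Z_1)+\lambda(Z_2)\ge \lambda(Z_1\lor Z_2)+\lambda(Z_1\land Z_2)+\mu\big((Z_1\cap Z_2)\setminus(Z_1\land Z_2)\big)$; - if $a\in Z\in\mathcal{L}$, then $\mu(\{a\})\le\lambda(Z)$; - $\lambda(Z)>0$ for every $Z\in\mathcal{L}$ with $Z\ne O_{\mathcal{L}}$, and $\mu(\{a\})>0$ for every $a\in M\setminus O_{\mathcal{L}}$. Moreover, when these hold, the polymatroid $(f,M)$ in (i) is unique, and $f$ is integer valued if and only if both $\lambda$ and $\mu$ are integer valued.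
   Context: All sets are finite. A polymatroid $(f,M)$ on ground set $M$ is a non-negative, monotone, submodular real function $f$ on the subsets of $M$ with $f(\emptyset)=0$. A subset $F\subseteq M$ is a flat of $(f,M)$ if $f(F')>f(F)$ for every $F'$ with $F\subsetneq F'\subseteq M$. A flat $C$ is cyclic if for every $i\in C$ either $f(\{i\})=0$ or $f(C)-f(C\setminus\{i\})<f(\{i\})$. A measure on $M$ is a non-negative additive function $\mu$ on the subsets of $M$, i.e. $\mu(A)=\sum_{a\in A}\mu(\{a\})$ with $\mu(\{a\})\ge 0$. A lattice $\mathcal{L}$ of subsets of $M$ is a non-empty collection of subsets of $M$ which is a lattice under the inclusion order: any $Z_1,Z_2\in\mathcal{L}$ have in $\mathcal{L}$ a least upper bound $Z_1\lor Z_2$ and a greatest lower bound $Z_1\land Z_2$ (these need not be the union and the intersection). Its smallest element is denoted $O_{\mathcal{L}}$. A ranked lattice $(\lambda,\mathcal{L})$ is such a lattice with a function $\lambda:\mathcal{L}\to\mathbb{R}_{\ge0}$. *)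

theory Defs
  imports Complex_Main "HOL-Algebra.Lattice"
begin

text \<open>
  Set functions are total functions of type \<^typ>\<open>'a set \<Rightarrow> real\<close>; only their values on subsets of
  the ground set \<open>M\<close> (for a rank function \<open>r\<close>: on the members of \<open>L\<close>) are meaningful.
\<close>

definition polymatroid :: "('a set \<Rightarrow> real) \<Rightarrow> 'a set \<Rightarrow> bool" where
  "polymatroid f M \<longleftrightarrow>
     finite M \<and>
     f {} = 0 \<and>
     (\<forall>A\<subseteq>M. 0 \<le> f A) \<and>
     mono_on (Pow M) f \<and>
     (\<forall>A\<subseteq>M. \<forall>B\<subseteq>M. f (A \<union> B) + f (A \<inter> B) \<le> f A + f B)"

definition flat :: "('a set \<Rightarrow> real) \<Rightarrow> 'a set \<Rightarrow> 'a set \<Rightarrow> bool" where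
  "flat f M F \<longleftrightarrow> F \<subseteq> M \<and> (\<forall>F'. F \<subset> F' \<and> F' \<subseteq> M \<longrightarrow> f F' > f F)"

definition cyclic_flat :: "('a set \<Rightarrow> real) \<Rightarrow> 'a set \<Rightarrow> 'a set \<Rightarrow> bool" where
  "cyclic_flat f M C \<longleftrightarrow> flat f M C \<and> (\<forall>i\<in>C. f {i} = 0 \<or> f C - f (C - {i}) < f {i})"

definition measure_on :: "'a set \<Rightarrow> ('a set \<Rightarrow> real) \<Rightarrow> bool" where
  "measure_on M \<mu> \<longleftrightarrow> finite M \<and> (\<forall>a\<in>M. 0 \<le> \<mu> {a}) \<and> (\<forall>A\<subseteq>M. \<mu> A = (\<Sum>a\<in>A. \<mu> {a}))"

text \<open>
  A family of sets viewed as an ordered structure under inclusion. Its joins, meets and bottom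
  are those of the family itself, so they may differ from union, intersection and \<open>{}\<close>.
\<close>
abbreviation inclusion_order :: "'a set set \<Rightarrow> 'a set gorder" where
  "inclusion_order L \<equiv> \<lparr>carrier = L, eq = (=), le = (\<subseteq>)\<rparr>"

definition ranked_lattice :: "'a set \<Rightarrow> ('a set \<Rightarrow> real) \<Rightarrow> 'a set set \<Rightarrow> bool" where
  "ranked_lattice M r L \<longleftrightarrow>
     L \<noteq> {} \<and> L \<subseteq> Pow M \<and> lattice (inclusion_order L) \<and> (\<forall>Z\<in>L. 0 \<le> r Z)"

definition represents ::
  "('a set \<Rightarrow> real) \<Rightarrow> 'a set \<Rightarrow> ('a set \<Rightarrow> real) \<Rightarrow> 'a set set \<Rightarrow> ('a set \<Rightarrow> real) \<Rightarrow> bool" where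
  "represents f M r L \<mu> \<longleftrightarrow>
     polymatroid f M \<and>
     L = {C. cyclic_flat f M C} \<and>
     (\<forall>Z\<in>L. r Z = f Z) \<and>
     (\<forall>a\<in>M. \<mu> {a} = f {a})"

definition cyclic_flat_conditions ::
  "'a set \<Rightarrow> ('a set \<Rightarrow> real) \<Rightarrow> 'a set set \<Rightarrow> ('a set \<Rightarrow> real) \<Rightarrow> bool" where
  "cyclic_flat_conditions M r L \<mu> \<longleftrightarrow>
     (let O\<^sub>L = \<bottom>\<^bsub>inclusion_order L\<^esub>;
          J = (\<lambda>Z\<^sub>1 Z\<^sub>2. Z\<^sub>1 \<squnion>\<^bsub>inclusion_order L\<^esub> Z\<^sub>2);
          K = (\<lambda>Z\<^sub>1 Z\<^sub>2. Z\<^sub>1 \<sqinter>\<^bsub>inclusion_order L\<^esub> Z\<^sub>2)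
      in r O\<^sub>L = 0 \<and>
         (\<forall>Z\<^sub>1\<in>L. \<forall>Z\<^sub>2\<in>L. Z\<^sub>1 \<subset> Z\<^sub>2 \<longrightarrow> 0 < r Z\<^sub>2 - r Z\<^sub>1 \<and> r Z\<^sub>2 - r Z\<^sub>1 < \<mu> (Z\<^sub>2 - Z\<^sub>1)) \<and>
         (\<forall>Z\<^sub>1\<in>L. \<forall>Z\<^sub>2\<in>L.
            r Z\<^sub>1 + r Z\<^sub>2 \<ge> r (J Z\<^sub>1 Z\<^sub>2) + r (K Z\<^sub>1 Z\<^sub>2) + \<mu> ((Z\<^sub>1 \<inter> Z\<^sub>2) - K Z\<^sub>1 Z\<^sub>2)) \<and>
         (\<forall>Z\<in>L. \<forall>a\<in>Z. \<mu> {a} \<le> r Z) \<and>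
         (\<forall>Z\<in>L. Z \<noteq> O\<^sub>L \<longrightarrow> 0 < r Z) \<and>
         (\<forall>a\<in>M - O\<^sub>L. 0 < \<mu> {a}))"

end

theory Submission
  imports Defs
begin

text \<open>
  The polymatroid is forced to be \<open>f A = min {r Z + \<mu> (A - Z) | Z \<in> L}\<close>. Submodularity gives one
  inequality. For the other, pass from \<open>A\<close> to its closure \<open>F\<close> and delete from \<open>F\<close>, one at a time,
  the elements \<open>i\<close> contributing their full rank \<open>f {i} > 0\<close>; the set stays a flat and the process
  ends in a cyclic flat \<open>C\<close> with \<open>f A = f C + \<mu> (A - C)\<close>. Conversely, under the conditions this
  minimum is submodular because the minimizers \<open>Y\<close> of \<open>A\<close> and \<open>Z\<close> of \<open>B\<close> can be replaced by their
  join for \<open>A \<union> B\<close> and their meet for \<open>A \<inter> B\<close>, and the strict inequalities between members of \<open>L\<close>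
  make them exactly the cyclic flats.
\<close>

section \<open>Polymatroids and their cyclic flats\<close>

lemma polymatroid_mono:
  "polymatroid f M \<Longrightarrow> A \<subseteq> B \<Longrightarrow> B \<subseteq> M \<Longrightarrow> f A \<le> f B"
  unfolding polymatroid_def by (meson PowI mono_onD order_trans)

lemma polymatroid_submodular:
  "polymatroid f M \<Longrightarrow> A \<subseteq> M \<Longrightarrow> B \<subseteq> M \<Longrightarrow> f (A \<union> B) + f (A \<inter> B) \<le> f A + f B"
  by (simp add: polymatroid_def)

lemma polymatroid_nonneg: "polymatroid f M \<Longrightarrow> A \<subseteq> M \<Longrightarrow> 0 \<le> f A"
  by (simp add: polymatroid_def)

lemma polymatroid_finite: "polymatroid f M \<Longrightarrow> A \<subseteq> M \<Longrightarrow> finite A"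
  unfolding polymatroid_def by (meson finite_subset)

lemma polymatroid_insert_le:
  assumes "polymatroid f M" "A \<subseteq> M" "x \<in> M"
  shows "f (insert x A) \<le> f A + f {x}"
proof -
  have "f (A \<union> {x}) + f (A \<inter> {x}) \<le> f A + f {x}"
    using assms by (intro polymatroid_submodular) auto
  moreover have "0 \<le> f (A \<inter> {x})"
    using assms by (intro polymatroid_nonneg[OF assms(1)]) auto
  ultimately show ?thesis by simp
qed

lemma polymatroid_union_le_sum:
  assumes "polymatroid f M" "A \<subseteq> M" "B \<subseteq> M"
  shows "f (A \<union> B) \<le> f A + (\<Sum>b\<in>B. f {b})"
  using polymatroid_finite[OF assms(1,3)] assms(3)
proof (induction B rule: finite_induct)
  case (insert x B)
  have "f (insert x (A \<union> B)) \<le> f (A \<union> B) + f {x}"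
    using polymatroid_insert_le[OF assms(1)] insert.prems assms(2) by simp
  with insert show ?case by simp
qed simp

lemma polymatroid_le_sum_Diff:
  assumes "polymatroid f M" "A \<subseteq> M" "Z \<subseteq> M"
  shows "f A \<le> f Z + (\<Sum>a\<in>A - Z. f {a})"
proof -
  have "f A \<le> f (Z \<union> (A - Z))" using assms by (intro polymatroid_mono) auto
  also have "\<dots> \<le> f Z + (\<Sum>a\<in>A - Z. f {a})"
    using assms by (intro polymatroid_union_le_sum) auto
  finally show ?thesis .
qed

text \<open>Any proper superset of \<open>F\<close> inside \<open>M\<close> contains some
  \<open>insert x F\<close>, so monotonicity reduces flatness to extensions by a single
  element.\<close>

lemma flat_iff:
  assumes "polymatroid f M"
  shows "flat f M F \<longleftrightarrow> F \<subseteq> M \<and> (\<forall>x\<in>M - F. f F < f (insert x F))"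
proof
  assume F: "flat f M F"
  have "f F < f (insert x F)" if "x \<in> M - F" for x
  proof -
    have "F \<subset> insert x F" "insert x F \<subseteq> M" using that F unfolding flat_def by auto
    then show ?thesis using F unfolding flat_def by simp
  qed
  with F show "F \<subseteq> M \<and> (\<forall>x\<in>M - F. f F < f (insert x F))" unfolding flat_def by simp
next
  assume F: "F \<subseteq> M \<and> (\<forall>x\<in>M - F. f F < f (insert x F))"
  have "f F < f F'" if F': "F \<subset> F'" "F' \<subseteq> M" for F'
  proof -
    obtain x where x: "x \<in> F' - F" using F' by blast
    then have "f F < f (insert x F)" using F F' by blast
    also have "\<dots> \<le> f F'" using x F' by (intro polymatroid_mono[OF assms]) auto
    finally show ?thesis .
  qed
  with F show "flat f M F" unfolding flat_def by blast
qed

text \<open>A point outside \<open>F \<inter> G\<close> is missing from one of the two flats.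
  Submodularity shows that it adds to the intersection at least as much rank as it adds to that
  flat.\<close>

lemma flat_Int:
  assumes f: "polymatroid f M" and F: "flat f M F" and G: "flat f M G"
  shows "flat f M (F \<inter> G)"
  unfolding flat_iff[OF f]
proof (intro conjI ballI)
  show FG: "F \<inter> G \<subseteq> M" using F unfolding flat_def by blast
  have *: "f (F \<inter> G) < f (insert x (F \<inter> G))" if "flat f M H" "F \<inter> G \<subseteq> H" "x \<in> M - H" for x H
  proof -
    have H: "H \<subseteq> M" "f H < f (insert x H)" using that flat_iff[OF f] by blast+
    have "f (H \<union> insert x (F \<inter> G)) + f (H \<inter> insert x (F \<inter> G)) \<le> f H + f (insert x (F \<inter> G))"
      using FG H that by (intro polymatroid_submodular[OF f]) auto
    moreover have "H \<union> insert x (F \<inter> G) = insert x H" "H \<inter> insert x (F \<inter> G) = F \<inter> G"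
      using that by auto
    ultimately show ?thesis using H by simp
  qed
  show "f (F \<inter> G) < f (insert x (F \<inter> G))" if "x \<in> M - F \<inter> G" for x
    using that *[OF F] *[OF G] by blast
qed

text \<open>A maximal superset of \<open>A\<close> among those of rank \<open>f A\<close> is flat,
  since any further enlargement must change the rank and monotonicity makes that change an
  increase.\<close>

lemma exists_flat_closure:
  assumes f: "polymatroid f M" and A: "A \<subseteq> M"
  obtains F where "flat f M F" "A \<subseteq> F" "f F = f A"
proof -
  let ?S = "{F. A \<subseteq> F \<and> F \<subseteq> M \<and> f F = f A}"
  have "finite M" using polymatroid_finite[OF f] by simp
  then have "finite ?S" by (intro finite_subset[of ?S "Pow M"]) auto
  moreover have "A \<in> ?S" using A by simp
  ultimately have "\<exists>F\<in>?S. A \<le> F \<and> (\<forall>G\<in>?S. F \<le> G \<longrightarrow> F = G)"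
    by (rule finite_has_maximal2)
  then obtain F where F: "F \<in> ?S" and max: "\<forall>G\<in>?S. F \<subseteq> G \<longrightarrow> F = G" by blast
  have "f F < f G" if "F \<subset> G" "G \<subseteq> M" for G
  proof -
    have "f F \<le> f G" using that by (intro polymatroid_mono[OF f]) auto
    moreover have "f G \<noteq> f F" using max F that by auto
    ultimately show ?thesis by simp
  qed
  with F have "flat f M F" unfolding flat_def by simp
  with that[of F] F show thesis by simp
qed

text \<open>If \<open>x\<close> raises the rank of \<open>F\<close>, it still raises that of
  \<open>F - {i}\<close>: putting \<open>i\<close> back costs at most \<open>f {i}\<close>, which is
  exactly what its removal saved. The point \<open>i\<close> itself raises the rank because
  \<open>f {i} > 0\<close>.\<close>

lemma flat_remove_coloop:
  assumes f: "polymatroid f M" and F: "flat f M F" and i: "i \<in> F" "f {i} > 0"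
    and coloop: "f F = f (F - {i}) + f {i}"
  shows "flat f M (F - {i})"
  unfolding flat_iff[OF f]
proof (intro conjI ballI)
  show FM: "F - {i} \<subseteq> M" using F unfolding flat_def by blast
  fix x assume x: "x \<in> M - (F - {i})"
  show "f (F - {i}) < f (insert x (F - {i}))"
  proof (cases "x = i")
    case True
    then show ?thesis using i coloop by (simp add: insert_absorb)
  next
    case False
    then have "f F < f (insert x F)" using x F by (simp add: flat_iff[OF f])
    also have "insert x F = insert i (insert x (F - {i}))" using i by blast
    also have "f \<dots> \<le> f (insert x (F - {i})) + f {i}"
      using FM x i F unfolding flat_def by (intro polymatroid_insert_le[OF f]) auto
    finally show ?thesis using coloop by simp
  qed
qed

text \<open>Induction on \<open>F\<close>: a flat that is not cyclic has a point of full positive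
  contribution, whose deletion leaves a smaller flat. The deleted ranks add up to the sum over
  \<open>F - C\<close>.\<close>

lemma flat_cyclic_part:
  assumes f: "polymatroid f M" and F: "flat f M F"
  obtains C where "cyclic_flat f M C" "C \<subseteq> F" "f F = f C + (\<Sum>a\<in>F - C. f {a})"
proof -
  have "finite F" using F f polymatroid_finite unfolding flat_def by blast
  then have "\<exists>C. cyclic_flat f M C \<and> C \<subseteq> F \<and> f F = f C + (\<Sum>a\<in>F - C. f {a})" using F
  proof (induction F rule: finite_psubset_induct)
    case (psubset F)
    have FM: "F \<subseteq> M" using psubset.prems unfolding flat_def by blast
    show ?case
    proof (cases "cyclic_flat f M F")
      case True
      then show ?thesis by (intro exI[of _ F]) simp
    next
      case False
      then obtain i where i: "i \<in> F" "f {i} \<noteq> 0" "f {i} \<le> f F - f (F - {i})"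
        using psubset.prems unfolding cyclic_flat_def by (auto simp: not_less)
      \<comment> \<open>Failure of cyclicity gives the reverse inequality, so \<open>i\<close>
        contributes exactly \<open>f {i}\<close>.\<close>
      have "f F \<le> f (F - {i}) + f {i}"
        using polymatroid_insert_le[OF f, of "F - {i}" i] FM i by (auto simp: insert_absorb)
      then have co: "f F = f (F - {i}) + f {i}" using i by simp
      have "0 \<le> f {i}" using i FM by (auto intro: polymatroid_nonneg[OF f])
      with i have "f {i} > 0" by simp
      then have "flat f M (F - {i})" using flat_remove_coloop[OF f psubset.prems i(1) _ co] by simp
      then obtain C where C: "cyclic_flat f M C" "C \<subseteq> F - {i}"
        "f (F - {i}) = f C + (\<Sum>a\<in>F - {i} - C. f {a})"
        using psubset.IH[of "F - {i}"] i by blast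
      have "F - C = insert i (F - {i} - C)" using C i by blast
      then have "(\<Sum>a\<in>F - C. f {a}) = f {i} + (\<Sum>a\<in>F - {i} - C. f {a})"
        using psubset.hyps by simp
      with C co show ?thesis by (intro exI[of _ C]) auto
    qed
  qed
  with that show thesis by blast
qed

text \<open>Take the cyclic part \<open>C\<close> of a closure \<open>F\<close> of \<open>A\<close>;
  \<open>C\<close> need not lie inside \<open>A\<close>. The bound
  \<open>f A \<le> f C + ...\<close> is subadditivity, and the converse holds because
  \<open>f A = f F\<close> while the sum over \<open>F - C\<close> dominates the one over
  \<open>A - C\<close>.\<close>

lemma polymatroid_rank_attained:
  assumes f: "polymatroid f M" and A: "A \<subseteq> M"
  obtains C where "cyclic_flat f M C" "f A = f C + (\<Sum>a\<in>A - C. f {a})"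
proof -
  obtain F where F: "flat f M F" "A \<subseteq> F" "f F = f A" using exists_flat_closure[OF f A] .
  obtain C where C: "cyclic_flat f M C" "C \<subseteq> F" "f F = f C + (\<Sum>a\<in>F - C. f {a})"
    using flat_cyclic_part[OF f F(1)] .
  have FM: "F \<subseteq> M" using F unfolding flat_def by blast
  have "f A \<le> f C + (\<Sum>a\<in>A - C. f {a})"
    using FM C A by (intro polymatroid_le_sum_Diff[OF f]) auto
  moreover have "(\<Sum>a\<in>A - C. f {a}) \<le> (\<Sum>a\<in>F - C. f {a})"
    using F FM polymatroid_finite[OF f FM] polymatroid_nonneg[OF f]
    by (intro sum_mono2) auto
  ultimately show thesis using that[of C] C F by simp
qed

text \<open>A closure of the union is again cyclic, which will bound the rank of the join of two
  cyclic flats by the rank of their union.\<close>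

lemma cyclic_flat_closure_Un:
  assumes f: "polymatroid f M" and Y: "cyclic_flat f M Y" and Z: "cyclic_flat f M Z"
  obtains F where "cyclic_flat f M F" "Y \<subseteq> F" "Z \<subseteq> F" "f F = f (Y \<union> Z)"
proof -
  have YZ: "Y \<union> Z \<subseteq> M" using Y Z unfolding cyclic_flat_def flat_def by blast
  obtain F where F: "flat f M F" "Y \<union> Z \<subseteq> F" "f F = f (Y \<union> Z)"
    using exists_flat_closure[OF f YZ] .
  have FM: "F \<subseteq> M" using F unfolding flat_def by blast
  \<comment> \<open>By submodularity, removing \<open>i\<close> from \<open>F\<close> loses at most
    as much rank as removing it from the smaller set \<open>C\<close>.\<close>
  have *: "f F - f (F - {i}) < f {i}"
    if C: "cyclic_flat f M C" "C \<subseteq> F" "i \<in> C" "f {i} \<noteq> 0" for C i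
  proof -
    have "f (C \<union> (F - {i})) + f (C \<inter> (F - {i})) \<le> f C + f (F - {i})"
      using FM C by (intro polymatroid_submodular[OF f]) auto
    moreover have "C \<union> (F - {i}) = F" "C \<inter> (F - {i}) = C - {i}" using C by auto
    moreover have "f C - f (C - {i}) < f {i}" using C unfolding cyclic_flat_def by blast
    ultimately show ?thesis by simp
  qed
  have "f {i} = 0 \<or> f F - f (F - {i}) < f {i}" if i: "i \<in> F" for i
  proof (cases "i \<in> Y \<union> Z")
    case True
    then show ?thesis using * Y Z F by blast
  next
    case False
    \<comment> \<open>Here \<open>F - {i}\<close> still contains \<open>Y \<union> Z\<close>, which
      already has the full rank of \<open>F\<close>, so deleting \<open>i\<close> loses
      nothing.\<close>
    then have "f (Y \<union> Z) \<le> f (F - {i})" using F FM by (intro polymatroid_mono[OF f]) auto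
    moreover have "0 \<le> f {i}" using i FM by (auto intro: polymatroid_nonneg[OF f])
    ultimately show ?thesis using F by linarith
  qed
  then show thesis using that[of F] F unfolding cyclic_flat_def by blast
qed

section \<open>Measures and lattices of sets\<close>

lemma measure_on_finite: "measure_on M \<mu> \<Longrightarrow> A \<subseteq> M \<Longrightarrow> finite A"
  unfolding measure_on_def by (meson finite_subset)

lemma measure_on_singleton_nonneg: "measure_on M \<mu> \<Longrightarrow> a \<in> M \<Longrightarrow> 0 \<le> \<mu> {a}"
  unfolding measure_on_def by (elim conjE) (drule (1) bspec)

lemma measure_on_eq_sum: "measure_on M \<mu> \<Longrightarrow> A \<subseteq> M \<Longrightarrow> \<mu> A = (\<Sum>a\<in>A. \<mu> {a})"
  unfolding measure_on_def by (elim conjE allE[of _ A] impE)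

text \<open>Writing every measure as a sum over all of \<open>M\<close> allows inequalities between
  sums of measures to be checked pointwise, as in the submodularity proof below.\<close>

lemma measure_on_eq_sum_if:
  assumes "measure_on M \<mu>" "A \<subseteq> M"
  shows "\<mu> A = (\<Sum>x\<in>M. if x \<in> A then \<mu> {x} else 0)"
proof -
  have "finite M" using measure_on_finite[OF assms(1)] by simp
  then have "(\<Sum>x\<in>M. if x \<in> A then \<mu> {x} else 0) = (\<Sum>x\<in>M \<inter> A. \<mu> {x})"
    by (rule sum.inter_restrict[symmetric])
  also have "M \<inter> A = A" using assms(2) by blast
  finally have "(\<Sum>x\<in>M. if x \<in> A then \<mu> {x} else 0) = (\<Sum>x\<in>A. \<mu> {x})" .
  with measure_on_eq_sum[OF assms] show ?thesis by (rule trans[OF _ sym])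
qed

lemma measure_on_Un:
  assumes "measure_on M \<mu>" "A \<subseteq> M" "B \<subseteq> M" "A \<inter> B = {}"
  shows "\<mu> (A \<union> B) = \<mu> A + \<mu> B"
proof -
  have "\<mu> (A \<union> B) = (\<Sum>a\<in>A \<union> B. \<mu> {a})"
    using assms by (intro measure_on_eq_sum) auto
  also have "\<dots> = (\<Sum>a\<in>A. \<mu> {a}) + (\<Sum>a\<in>B. \<mu> {a})"
    using assms measure_on_finite[OF assms(1)] by (intro sum.union_disjoint) auto
  also have "\<dots> = \<mu> A + \<mu> B"
    by (rule arg_cong2[where f = "(+)", OF assms(2,3)[THEN measure_on_eq_sum[OF assms(1)], symmetric]])
  finally show ?thesis .
qed

lemma measure_on_nonneg:
  assumes "measure_on M \<mu>" "A \<subseteq> M"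
  shows "0 \<le> \<mu> A"
proof -
  have "0 \<le> (\<Sum>a\<in>A. \<mu> {a})"
    using assms by (intro sum_nonneg measure_on_singleton_nonneg[OF assms(1)]) auto
  also have "\<dots> = \<mu> A" using measure_on_eq_sum[OF assms] by (rule sym)
  finally show ?thesis .
qed

lemma measure_on_mono:
  assumes "measure_on M \<mu>" "A \<subseteq> B" "B \<subseteq> M"
  shows "\<mu> A \<le> \<mu> B"
proof -
  have "\<mu> (A \<union> (B - A)) = \<mu> A + \<mu> (B - A)"
    using assms by (intro measure_on_Un[OF assms(1)]) auto
  moreover have "A \<union> (B - A) = B" using assms by blast
  moreover have "0 \<le> \<mu> (B - A)" using assms by (intro measure_on_nonneg) auto
  ultimately show ?thesis by simp
qed

lemma measure_on_empty: "measure_on M \<mu> \<Longrightarrow> \<mu> {} = 0"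
  using measure_on_eq_sum[of M \<mu> "{}"] by simp

section \<open>Joins, meets and least element of a family under inclusion\<close>

lemma inclusion_join:
  assumes "lattice (inclusion_order L)" "Y \<in> L" "Z \<in> L"
  shows "Y \<squnion>\<^bsub>inclusion_order L\<^esub> Z \<in> L"
    and "Y \<subseteq> Y \<squnion>\<^bsub>inclusion_order L\<^esub> Z"
    and "Z \<subseteq> Y \<squnion>\<^bsub>inclusion_order L\<^esub> Z"
    and "X \<in> L \<Longrightarrow> Y \<subseteq> X \<Longrightarrow> Z \<subseteq> X \<Longrightarrow> Y \<squnion>\<^bsub>inclusion_order L\<^esub> Z \<subseteq> X"
proof -
  interpret lattice "inclusion_order L" by fact
  show "Y \<squnion>\<^bsub>inclusion_order L\<^esub> Z \<in> L" "Y \<subseteq> Y \<squnion>\<^bsub>inclusion_order L\<^esub> Z"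
    "Z \<subseteq> Y \<squnion>\<^bsub>inclusion_order L\<^esub> Z"
    using join_closed[of Y Z] join_left[of Y Z] join_right[of Y Z] assms by simp_all
  show "X \<in> L \<Longrightarrow> Y \<subseteq> X \<Longrightarrow> Z \<subseteq> X \<Longrightarrow> Y \<squnion>\<^bsub>inclusion_order L\<^esub> Z \<subseteq> X"
    using join_le[of Y X Z] assms by simp
qed

lemma inclusion_meet:
  assumes "lattice (inclusion_order L)" "Y \<in> L" "Z \<in> L"
  shows "Y \<sqinter>\<^bsub>inclusion_order L\<^esub> Z \<in> L"
    and "Y \<sqinter>\<^bsub>inclusion_order L\<^esub> Z \<subseteq> Y"
    and "Y \<sqinter>\<^bsub>inclusion_order L\<^esub> Z \<subseteq> Z"
    and "X \<in> L \<Longrightarrow> X \<subseteq> Y \<Longrightarrow> X \<subseteq> Z \<Longrightarrow> X \<subseteq> Y \<sqinter>\<^bsub>inclusion_order L\<^esub> Z"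
proof -
  interpret lattice "inclusion_order L" by fact
  show "Y \<sqinter>\<^bsub>inclusion_order L\<^esub> Z \<in> L" "Y \<sqinter>\<^bsub>inclusion_order L\<^esub> Z \<subseteq> Y"
    "Y \<sqinter>\<^bsub>inclusion_order L\<^esub> Z \<subseteq> Z"
    using meet_closed[of Y Z] meet_left[of Y Z] meet_right[of Y Z] assms by simp_all
  show "X \<in> L \<Longrightarrow> X \<subseteq> Y \<Longrightarrow> X \<subseteq> Z \<Longrightarrow> X \<subseteq> Y \<sqinter>\<^bsub>inclusion_order L\<^esub> Z"
    using meet_le[of X Y Z] assms by simp
qed

text \<open>The bottom is defined by choice, so a least member must be exhibited. A minimal member
  exists by finiteness, and its meet with any other member lies below it, hence equals it.\<close>

lemma inclusion_bottom:
  assumes "lattice (inclusion_order L)" "finite L" "L \<noteq> {}"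
  shows "\<bottom>\<^bsub>inclusion_order L\<^esub> \<in> L"
    and "Z \<in> L \<Longrightarrow> \<bottom>\<^bsub>inclusion_order L\<^esub> \<subseteq> Z"
proof -
  obtain X where X: "X \<in> L" and min: "\<And>Y. Y \<in> L \<Longrightarrow> Y \<subseteq> X \<Longrightarrow> X = Y"
    using finite_has_minimal[OF assms(2,3)] by metis
  have "X \<subseteq> Y" if "Y \<in> L" for Y
    using inclusion_meet[OF assms(1) X that] min by metis
  with X have "least (inclusion_order L) X (carrier (inclusion_order L))"
    by (simp add: least_def)
  then have "least (inclusion_order L) \<bottom>\<^bsub>inclusion_order L\<^esub> (carrier (inclusion_order L))"
    unfolding bottom_def by (rule someI)
  then show "\<bottom>\<^bsub>inclusion_order L\<^esub> \<in> L" "Z \<in> L \<Longrightarrow> \<bottom>\<^bsub>inclusion_order L\<^esub> \<subseteq> Z"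
    by (simp_all add: least_def)
qed

lemma ranked_lattice_finite: "finite M \<Longrightarrow> ranked_lattice M r L \<Longrightarrow> finite L"
  unfolding ranked_lattice_def by (meson finite_Pow_iff finite_subset)

section \<open>The conditions are necessary\<close>

lemma represents_polymatroid: "represents f M r L \<mu> \<Longrightarrow> polymatroid f M"
  and represents_mem_iff: "represents f M r L \<mu> \<Longrightarrow> Z \<in> L \<longleftrightarrow> cyclic_flat f M Z"
  and represents_rank_eq: "represents f M r L \<mu> \<Longrightarrow> Z \<in> L \<Longrightarrow> r Z = f Z"
  and represents_singleton_eq: "represents f M r L \<mu> \<Longrightarrow> a \<in> M \<Longrightarrow> \<mu> {a} = f {a}"
  unfolding represents_def by (elim conjE, simp)+

lemma cyclic_flat_subset: "cyclic_flat f M C \<Longrightarrow> C \<subseteq> M"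
  by (simp add: cyclic_flat_def flat_def)

lemma represents_measure_eq_sum:
  assumes "represents f M r L \<mu>" "measure_on M \<mu>" "A \<subseteq> M"
  shows "\<mu> A = (\<Sum>a\<in>A. f {a})"
proof -
  have "\<mu> A = (\<Sum>a\<in>A. \<mu> {a})" using measure_on_eq_sum[OF assms(2,3)] .
  also have "\<dots> = (\<Sum>a\<in>A. f {a})"
    using assms(3) by (intro sum.cong) (auto intro: represents_singleton_eq[OF assms(1)])
  finally show ?thesis .
qed

lemma represents_le:
  assumes "represents f M r L \<mu>" "measure_on M \<mu>" "A \<subseteq> M" "Z \<in> L"
  shows "f A \<le> r Z + \<mu> (A - Z)"
proof -
  have "cyclic_flat f M Z" using represents_mem_iff[OF assms(1)] assms(4) by simp
  then have "Z \<subseteq> M" by (rule cyclic_flat_subset)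
  then have "f A \<le> f Z + (\<Sum>a\<in>A - Z. f {a})"
    by (rule polymatroid_le_sum_Diff[OF represents_polymatroid[OF assms(1)] assms(3)])
  moreover have "\<mu> (A - Z) = (\<Sum>a\<in>A - Z. f {a})"
    using assms(3) by (intro represents_measure_eq_sum[OF assms(1,2)]) auto
  ultimately show ?thesis using represents_rank_eq[OF assms(1,4)] by simp
qed

lemma represents_attained:
  assumes "represents f M r L \<mu>" "measure_on M \<mu>" "A \<subseteq> M"
  obtains Z where "Z \<in> L" "f A = r Z + \<mu> (A - Z)"
proof -
  have f: "polymatroid f M" using represents_polymatroid[OF assms(1)] .
  obtain C where C: "cyclic_flat f M C" "f A = f C + (\<Sum>a\<in>A - C. f {a})"
    using polymatroid_rank_attained[OF f assms(3)] .
  moreover have "\<mu> (A - C) = (\<Sum>a\<in>A - C. f {a})"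
    using assms(3) by (intro represents_measure_eq_sum[OF assms(1,2)]) auto
  moreover have "C \<in> L" using C(1) represents_mem_iff[OF assms(1)] by simp
  ultimately show thesis using that[of C] represents_rank_eq[OF assms(1)] by simp
qed

text \<open>Both values are the minimum of \<open>r Z + \<mu> (A - Z)\<close> over \<open>Z\<close>
  in \<open>L\<close>: a minimizer for one function bounds the other.\<close>

lemma represents_unique:
  assumes "represents f M r L \<mu>" "represents g M r L \<mu>" "measure_on M \<mu>" "A \<subseteq> M"
  shows "f A = g A"
proof (rule antisym)
  show "f A \<le> g A"
    by (rule represents_attained[OF assms(2-4)]) (simp add: represents_le[OF assms(1,3,4)])
  show "g A \<le> f A"
    by (rule represents_attained[OF assms(1,3,4)]) (simp add: represents_le[OF assms(2-4)])
qed

text \<open>In one direction \<open>r\<close> restricts \<open>f\<close> and \<mu> sums its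
  singleton values; in the other, \<open>f A\<close> equals some
  \<open>r Z + \<mu> (A - Z)\<close>.\<close>

lemma represents_integral_iff:
  assumes rep: "represents f M r L \<mu>" and \<mu>: "measure_on M \<mu>"
  shows "(\<forall>A\<subseteq>M. f A \<in> \<int>) \<longleftrightarrow> (\<forall>Z\<in>L. r Z \<in> \<int>) \<and> (\<forall>A\<subseteq>M. \<mu> A \<in> \<int>)"
proof (intro iffI conjI ballI allI impI)
  assume int: "\<forall>A\<subseteq>M. f A \<in> \<int>"
  show "r Z \<in> \<int>" if "Z \<in> L" for Z
    using that int represents_rank_eq[OF rep that] represents_mem_iff[OF rep] cyclic_flat_subset
    by metis
  show "\<mu> A \<in> \<int>" if "A \<subseteq> M" for A
    unfolding represents_measure_eq_sum[OF rep \<mu> that] using that int by (intro Ints_sum) auto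
next
  fix A assume int: "(\<forall>Z\<in>L. r Z \<in> \<int>) \<and> (\<forall>A\<subseteq>M. \<mu> A \<in> \<int>)" and A: "A \<subseteq> M"
  obtain Z where "Z \<in> L" "f A = r Z + \<mu> (A - Z)" using represents_attained[OF rep \<mu> A] .
  moreover have "A - Z \<subseteq> M" using A by blast
  ultimately show "f A \<in> \<int>" using int by simp
qed

lemma represents_imp_conditions:
  assumes L: "ranked_lattice M r L" and \<mu>: "measure_on M \<mu>" and rep: "represents f M r L \<mu>"
  shows "cyclic_flat_conditions M r L \<mu>"
proof -
  let ?L = "inclusion_order L"
  let ?O = "\<bottom>\<^bsub>?L\<^esub>"
  note f = represents_polymatroid[OF rep] and Leq = represents_mem_iff[OF rep]
    and r = represents_rank_eq[OF rep] and \<mu>f = represents_singleton_eq[OF rep]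
  have lat: "lattice ?L" and ne: "L \<noteq> {}" and LM: "\<And>Z. Z \<in> L \<Longrightarrow> Z \<subseteq> M"
    using L unfolding ranked_lattice_def by blast+
  have flat: "\<And>Z. Z \<in> L \<Longrightarrow> flat f M Z" using Leq unfolding cyclic_flat_def by blast
  have "finite M" using polymatroid_finite[OF f] by simp
  then have fin: "finite L" using L ranked_lattice_finite by blast
  note bot = inclusion_bottom[OF lat fin ne]
  \<comment> \<open>The formula at the empty set produces a cyclic flat of rank zero; the bottom
    lies below it and so has rank zero too.\<close>
  obtain Z0 where "Z0 \<in> L" "f {} = r Z0 + \<mu> ({} - Z0)"
    using represents_attained[OF rep \<mu>, of "{}"] by auto
  moreover have "f {} = 0" using f by (simp add: polymatroid_def)
  ultimately have "f Z0 = 0" "Z0 \<in> L" using r measure_on_empty[OF \<mu>] by simp_all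
  then have "f ?O \<le> 0" using polymatroid_mono[OF f bot(2) LM, of Z0] by simp
  moreover have "0 \<le> f ?O" using polymatroid_nonneg[OF f LM[OF bot(1)]] .
  ultimately have fO: "f ?O = 0" by simp
  \<comment> \<open>The bottom is a flat of rank zero, so adding \<open>a\<close> yields positive
    rank, and subadditivity bounds this rank by \<open>f {a}\<close>.\<close>
  have pos: "0 < f {a}" if "a \<in> M - ?O" for a
  proof -
    have "f ?O < f (insert a ?O)" using flat[OF bot(1)] that flat_iff[OF f] by blast
    also have "\<dots> \<le> f ?O + f {a}" using that LM[OF bot(1)]
      by (intro polymatroid_insert_le[OF f]) auto
    finally show ?thesis by simp
  qed
  have mono: "f Y < f Z" if "Y \<in> L" "Z \<in> L" "Y \<subset> Z" for Y Z
    using that flat LM unfolding flat_def by blast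
  \<comment> \<open>Delete one point \<open>i\<close> of \<open>Z - Y\<close>: cyclicity of
    \<open>Z\<close> makes the loss strictly less than \<open>f {i}\<close>, and
    \<open>represents_le\<close> with \<open>Y\<close> bounds the rank of the rest.\<close>
  have upper: "f Z - f Y < \<mu> (Z - Y)" if YZ: "Y \<in> L" "Z \<in> L" "Y \<subset> Z" for Y Z
  proof -
    obtain i where i: "i \<in> Z" "i \<notin> Y" using YZ by blast
    then have "i \<in> M - ?O" using YZ LM bot(2) by blast
    with pos have "f {i} \<noteq> 0" by force
    then have "f Z - f (Z - {i}) < f {i}" using i YZ Leq unfolding cyclic_flat_def by blast
    moreover have "f (Z - {i}) \<le> r Y + \<mu> (Z - {i} - Y)"
      using YZ LM[OF YZ(2)] by (intro represents_le[OF rep \<mu>]) auto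
    moreover have "\<mu> {i} = f {i}" using \<open>i \<in> M - ?O\<close> \<mu>f by blast
    ultimately have "f Z < f Y + \<mu> (Z - {i} - Y) + \<mu> {i}" using r[OF YZ(1)] by simp
    moreover have "\<mu> (Z - {i} - Y \<union> {i}) = \<mu> (Z - {i} - Y) + \<mu> {i}"
      using i YZ LM[OF YZ(2)] by (intro measure_on_Un[OF \<mu>]) auto
    moreover have "Z - {i} - Y \<union> {i} = Z - Y" using i by blast
    ultimately show ?thesis by simp
  qed
  \<comment> \<open>The join lies below a cyclic closure of \<open>Y \<union> Z\<close>, and the
    meet \<open>?K\<close> lies above the cyclic part \<open>C\<close> of the flat
    \<open>Y \<inter> Z\<close>. Splitting \<open>Y \<inter> Z - C\<close> at \<open>?K\<close>
    supplies the measure term; then submodularity of \<open>f\<close> applies.\<close>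
  have sub: "f Y + f Z \<ge> f (Y \<squnion>\<^bsub>?L\<^esub> Z) + f (Y \<sqinter>\<^bsub>?L\<^esub> Z) + \<mu> (Y \<inter> Z - Y \<sqinter>\<^bsub>?L\<^esub> Z)"
    if YZ: "Y \<in> L" "Z \<in> L" for Y Z
  proof -
    note J = inclusion_join[OF lat YZ] and K = inclusion_meet[OF lat YZ]
    let ?K = "Y \<sqinter>\<^bsub>?L\<^esub> Z"
    obtain F where F: "cyclic_flat f M F" "Y \<subseteq> F" "Z \<subseteq> F" "f F = f (Y \<union> Z)"
      using cyclic_flat_closure_Un[OF f] YZ Leq by blast
    then have "F \<in> L" using Leq by blast
    then have 1: "f (Y \<squnion>\<^bsub>?L\<^esub> Z) \<le> f (Y \<union> Z)"
      using polymatroid_mono[OF f J(4)[of F] LM[of F]] F by simp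
    obtain C where C: "cyclic_flat f M C" "C \<subseteq> Y \<inter> Z"
      "f (Y \<inter> Z) = f C + (\<Sum>a\<in>Y \<inter> Z - C. f {a})"
      using flat_cyclic_part[OF f flat_Int[OF f flat flat], of Y Z] YZ by blast
    then have CL: "C \<in> L" using Leq by blast
    have CK: "C \<subseteq> ?K" using K(4)[OF CL] C by blast
    have YZM: "Y \<inter> Z \<subseteq> M" using LM YZ by blast
    have "\<mu> (Y \<inter> Z - C) = (\<Sum>a\<in>Y \<inter> Z - C. f {a})"
      using YZM by (intro represents_measure_eq_sum[OF rep \<mu>]) auto
    with C have "f (Y \<inter> Z) = f C + \<mu> (Y \<inter> Z - C)" by simp
    moreover have "f ?K \<le> r C + \<mu> (?K - C)"
      using represents_le[OF rep \<mu> LM[OF K(1)] CL] .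
    moreover have "\<mu> ((?K - C) \<union> (Y \<inter> Z - ?K)) = \<mu> (?K - C) + \<mu> (Y \<inter> Z - ?K)"
      using YZM K(2) K(3) by (intro measure_on_Un[OF \<mu>]) auto
    moreover have "(?K - C) \<union> (Y \<inter> Z - ?K) = Y \<inter> Z - C" using K(2,3) CK by blast
    ultimately have 2: "f ?K + \<mu> (Y \<inter> Z - ?K) \<le> f (Y \<inter> Z)" using r[OF CL] by simp
    show ?thesis using 1 2 polymatroid_submodular[OF f LM LM, OF YZ] by simp
  qed
  have "0 < f Z" if "Z \<in> L" "Z \<noteq> ?O" for Z
    using mono[OF bot(1) that(1)] bot(2)[OF that(1)] that fO by auto
  moreover have "f {a} \<le> f Z" if "Z \<in> L" "a \<in> Z" for a Z
    using that LM[OF that(1)] by (intro polymatroid_mono[OF f]) auto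
  moreover have "a \<in> M" if "Z \<in> L" "a \<in> Z" for a Z using that LM by blast
  ultimately show ?thesis
    unfolding cyclic_flat_conditions_def Let_def
    using r bot inclusion_join(1)[OF lat] inclusion_meet(1)[OF lat] fO pos mono upper sub \<mu>f
    by simp
qed

section \<open>The conditions are sufficient\<close>

locale cyclic_flat_axioms =
  fixes M :: "'a set" and L :: "'a set set" and r \<mu> :: "'a set \<Rightarrow> real"
  assumes finite_ground: "finite M"
    and ranked: "ranked_lattice M r L"
    and measure: "measure_on M \<mu>"
    and conditions: "cyclic_flat_conditions M r L \<mu>"
begin

abbreviation bot_set :: "'a set" where
  "bot_set \<equiv> \<bottom>\<^bsub>inclusion_order L\<^esub>"

abbreviation lub :: "'a set \<Rightarrow> 'a set \<Rightarrow> 'a set" where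
  "lub Y Z \<equiv> Y \<squnion>\<^bsub>inclusion_order L\<^esub> Z"

abbreviation glb :: "'a set \<Rightarrow> 'a set \<Rightarrow> 'a set" where
  "glb Y Z \<equiv> Y \<sqinter>\<^bsub>inclusion_order L\<^esub> Z"

lemma lattice_L: "lattice (inclusion_order L)"
  and L_nonempty: "L \<noteq> {}"
  and subset_ground: "Z \<in> L \<Longrightarrow> Z \<subseteq> M"
  and r_nonneg: "Z \<in> L \<Longrightarrow> 0 \<le> r Z"
  using ranked unfolding ranked_lattice_def by blast+

lemmas finite_L = ranked_lattice_finite[OF finite_ground ranked]
lemmas lub_props = inclusion_join[OF lattice_L]
lemmas glb_props = inclusion_meet[OF lattice_L]
lemmas bot_set_props = inclusion_bottom[OF lattice_L finite_L L_nonempty]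

lemma r_bot: "r bot_set = 0"
  and r_strict_mono: "Y \<in> L \<Longrightarrow> Z \<in> L \<Longrightarrow> Y \<subset> Z \<Longrightarrow> r Y < r Z"
  and r_diff_less: "Y \<in> L \<Longrightarrow> Z \<in> L \<Longrightarrow> Y \<subset> Z \<Longrightarrow> r Z - r Y < \<mu> (Z - Y)"
  and r_submodular: "Y \<in> L \<Longrightarrow> Z \<in> L \<Longrightarrow>
    r (lub Y Z) + r (glb Y Z) + \<mu> (Y \<inter> Z - glb Y Z) \<le> r Y + r Z"
  and \<mu>_le_r: "Z \<in> L \<Longrightarrow> a \<in> Z \<Longrightarrow> \<mu> {a} \<le> r Z"
  and \<mu>_pos: "a \<in> M - bot_set \<Longrightarrow> 0 < \<mu> {a}"
  using conditions unfolding cyclic_flat_conditions_def Let_def by auto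

lemma \<mu>_pos_outside: "Z \<in> L \<Longrightarrow> a \<in> M - Z \<Longrightarrow> 0 < \<mu> {a}"
  using \<mu>_pos bot_set_props(2) by blast

text \<open>This is the formula forced by \<open>represents_le\<close> and
  \<open>represents_attained\<close>; the minimum exists because \<open>L\<close> is finite and
  nonempty.\<close>

definition rank :: "'a set \<Rightarrow> real" where
  "rank A = Min ((\<lambda>Z. r Z + \<mu> (A - Z)) ` L)"

lemma rank_le: "Z \<in> L \<Longrightarrow> rank A \<le> r Z + \<mu> (A - Z)"
  unfolding rank_def using finite_L by simp

lemma rank_attained:
  obtains Z where "Z \<in> L" "rank A = r Z + \<mu> (A - Z)"
proof -
  have "rank A \<in> (\<lambda>Z. r Z + \<mu> (A - Z)) ` L"
    unfolding rank_def using finite_L L_nonempty by (intro Min_in) auto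
  with that show thesis by blast
qed

lemma rank_mono:
  assumes "A \<subseteq> B" "B \<subseteq> M"
  shows "rank A \<le> rank B"
proof -
  obtain Z where Z: "Z \<in> L" "rank B = r Z + \<mu> (B - Z)" by (rule rank_attained)
  moreover have "\<mu> (A - Z) \<le> \<mu> (B - Z)" using assms by (intro measure_on_mono[OF measure]) auto
  ultimately show ?thesis using rank_le[of Z A] by simp
qed

lemma rank_nonneg: "A \<subseteq> M \<Longrightarrow> 0 \<le> rank A"
  by (rule rank_attained[of A])
    (simp add: r_nonneg measure_on_nonneg[OF measure] Diff_subset[THEN subset_trans])

lemma rank_empty: "rank {} = 0"
  using rank_le[OF bot_set_props(1), of "{}"] rank_nonneg[of "{}"] r_bot measure_on_empty[OF measure]
  by simp

lemma rank_submodular: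
  assumes "A \<subseteq> M" "B \<subseteq> M"
  shows "rank (A \<union> B) + rank (A \<inter> B) \<le> rank A + rank B"
proof -
  obtain Y where Y: "Y \<in> L" "rank A = r Y + \<mu> (A - Y)" by (rule rank_attained)
  obtain Z where Z: "Z \<in> L" "rank B = r Z + \<mu> (B - Z)" by (rule rank_attained)
  let ?J = "lub Y Z" and ?K = "glb Y Z"
  note J = lub_props[OF Y(1) Z(1)] and K = glb_props[OF Y(1) Z(1)]
  have sums: "\<mu> X = (\<Sum>x\<in>M. if x \<in> X then \<mu> {x} else 0)" if "X \<subseteq> M" for X
    using measure_on_eq_sum_if[OF measure that] .
  \<comment> \<open>Compare the weight of each point. Outside \<open>?J\<close> it avoids both
    \<open>Y\<close> and \<open>Z\<close>, so it is counted in \<open>A - Y\<close> or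
    \<open>B - Z\<close>, and in both if it lies in \<open>A \<inter> B\<close>. A point of
    \<open>A \<inter> B - ?K\<close> inside \<open>?J\<close> lies in
    \<open>Y \<inter> Z - ?K\<close> or avoids one of \<open>Y\<close>, \<open>Z\<close>.\<close>
  have "\<mu> (A \<union> B - ?J) + \<mu> (A \<inter> B - ?K) \<le> \<mu> (Y \<inter> Z - ?K) + \<mu> (A - Y) + \<mu> (B - Z)"
  proof -
    have "A \<union> B - ?J \<subseteq> M" "A \<inter> B - ?K \<subseteq> M" "Y \<inter> Z - ?K \<subseteq> M" "A - Y \<subseteq> M" "B - Z \<subseteq> M"
      using assms subset_ground[OF Y(1)] by auto
    note eqs = this[THEN sums]
    note measure_on_singleton_nonneg[OF measure]
    then show ?thesis
      unfolding eqs sum.distrib[symmetric] using J(2,3) by (intro sum_mono) auto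
  qed
  moreover have "rank (A \<union> B) \<le> r ?J + \<mu> (A \<union> B - ?J)" using rank_le[OF J(1)] .
  moreover have "rank (A \<inter> B) \<le> r ?K + \<mu> (A \<inter> B - ?K)" using rank_le[OF K(1)] .
  ultimately show ?thesis using r_submodular[OF Y(1) Z(1)] Y Z by linarith
qed

lemma polymatroid_rank: "polymatroid rank M"
  unfolding polymatroid_def mono_on_def
  using finite_ground rank_empty rank_nonneg rank_mono rank_submodular by auto

text \<open>The bottom set gives the upper bound. For the lower bound, a minimizer containing
  \<open>a\<close> is handled by \<open>\<mu>_le_r\<close>, any other by nonnegativity of
  \<open>r\<close>.\<close>

lemma rank_singleton:
  assumes "a \<in> M"
  shows "rank {a} = \<mu> {a}"
proof (rule antisym)
  show "rank {a} \<le> \<mu> {a}"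
  proof (cases "a \<in> bot_set")
    case True
    moreover have "0 \<le> \<mu> {a}" using measure_on_singleton_nonneg[OF measure assms] .
    ultimately show ?thesis
      using rank_le[OF bot_set_props(1), of "{a}"] r_bot measure_on_empty[OF measure] by simp
  next
    case False
    then have "{a} - bot_set = {a}" by blast
    then show ?thesis using rank_le[OF bot_set_props(1), of "{a}"] r_bot by simp
  qed
  obtain Z where Z: "Z \<in> L" "rank {a} = r Z + \<mu> ({a} - Z)" by (rule rank_attained)
  show "\<mu> {a} \<le> rank {a}"
  proof (cases "a \<in> Z")
    case True
    then show ?thesis using Z \<mu>_le_r[OF Z(1)] measure_on_empty[OF measure] by simp
  next
    case False
    then have "{a} - Z = {a}" by blast
    then show ?thesis using Z r_nonneg[OF Z(1)] by simp
  qed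
qed

section \<open>The cyclic flats of \<open>rank\<close> are the members of \<open>L\<close>\<close>

lemma r_mono: "Y \<in> L \<Longrightarrow> Z \<in> L \<Longrightarrow> Y \<subseteq> Z \<Longrightarrow> r Y \<le> r Z"
  using r_strict_mono by (cases "Y = Z") (auto intro: less_imp_le)

text \<open>The equality case is what shows that members of \<open>L\<close> are flats and are cyclic.\<close>

lemma r_le_add_measure:
  assumes Y: "Y \<in> L" and Z: "Z \<in> L"
  shows "r Z \<le> r Y + \<mu> (Z - Y)"
    and "r Z = r Y + \<mu> (Z - Y) \<Longrightarrow> Y = Z"
proof -
  let ?J = "lub Y Z" and ?K = "glb Y Z"
  note J = lub_props[OF Y Z] and K = glb_props[OF Y Z]
  have "\<mu> (Y \<inter> Z - ?K \<union> (Z - Y)) = \<mu> (Y \<inter> Z - ?K) + \<mu> (Z - Y)"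
    using subset_ground[OF Z] by (intro measure_on_Un[OF measure]) auto
  moreover have "Y \<inter> Z - ?K \<union> (Z - Y) = Z - ?K" using K(2,3) by blast
  ultimately have split: "\<mu> (Z - ?K) = \<mu> (Y \<inter> Z - ?K) + \<mu> (Z - Y)" by simp
  have K_le: "r Z - r ?K \<le> \<mu> (Z - ?K)"
  proof (cases "?K = Z")
    case True
    then show ?thesis using measure_on_empty[OF measure] by simp
  next
    case False
    then have "?K \<subset> Z" using K(3) by blast
    then show ?thesis using r_diff_less[OF K(1) Z] by simp
  qed
  have J_le: "r Z \<le> r ?J" using r_mono[OF Z J(1) J(3)] .
  note sub = r_submodular[OF Y Z]
  \<comment> \<open>Cancelling \<open>r Z \<le> r ?J\<close> in submodularity leaves
    \<open>r ?K + \<mu> (Y \<inter> Z - ?K) \<le> r Y\<close>; bounding \<open>r Z\<close> through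
    \<open>?K\<close> finishes.\<close>
  show "r Z \<le> r Y + \<mu> (Z - Y)" using split K_le J_le sub by linarith
  assume eq: "r Z = r Y + \<mu> (Z - Y)"
  \<comment> \<open>Equality makes both auxiliary bounds tight, and the strict conditions on
    \<open>L\<close> then force \<open>Z\<close> to be both the join and the meet.\<close>
  then have "r Z = r ?J" "r Z - r ?K = \<mu> (Z - ?K)" using split K_le J_le sub by linarith+
  then have "Z = ?J" "Z = ?K"
    using r_strict_mono[OF Z J(1)] J(3) r_diff_less[OF K(1) Z] K(3) by fastforce+
  with J(2) K(2) show "Y = Z" by blast
qed

lemma rank_eq_r:
  assumes "Z \<in> L"
  shows "rank Z = r Z"
proof (rule antisym)
  show "rank Z \<le> r Z" using rank_le[OF assms, of Z] measure_on_empty[OF measure] by simp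
  show "r Z \<le> rank Z" using r_le_add_measure(1)[OF _ assms] by (metis rank_attained)
qed

text \<open>Let \<open>Y\<close> be a minimizer for \<open>insert x Z\<close>. If \<open>x\<close>
  is in \<open>Y\<close>, then \<open>Y\<close> differs from \<open>Z\<close> and the comparison of
  \<open>r Z\<close> with \<open>Y\<close> is strict; otherwise \<open>x\<close> adds its positive
  measure.\<close>

lemma flat_L:
  assumes Z: "Z \<in> L"
  shows "flat rank M Z"
  unfolding flat_iff[OF polymatroid_rank]
proof (intro conjI ballI)
  show ZM: "Z \<subseteq> M" using subset_ground[OF Z] .
  fix x assume x: "x \<in> M - Z"
  obtain Y where Y: "Y \<in> L" "rank (insert x Z) = r Y + \<mu> (insert x Z - Y)" by (rule rank_attained)
  have pos: "0 < \<mu> {x}" using \<mu>_pos_outside[OF Z x] .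
  have le: "\<mu> (Z - Y) \<le> \<mu> (insert x Z - Y)"
    using ZM x by (intro measure_on_mono[OF measure]) auto
  show "rank Z < rank (insert x Z)"
  proof (cases "x \<in> Y")
    case True
    then have "r Z \<noteq> r Y + \<mu> (Z - Y)" using r_le_add_measure(2)[OF Y(1) Z] x by blast
    then show ?thesis using le r_le_add_measure(1)[OF Y(1) Z] Y rank_eq_r[OF Z] by simp
  next
    case False
    have "\<mu> ((Z - Y) \<union> {x}) = \<mu> (Z - Y) + \<mu> {x}"
      using ZM x by (intro measure_on_Un[OF measure]) auto
    moreover have "(Z - Y) \<union> {x} = insert x Z - Y" using False by blast
    ultimately show ?thesis
      using pos r_le_add_measure(1)[OF Y(1) Z] Y rank_eq_r[OF Z] by simp
  qed
qed

lemma cyclic_flat_L: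
  assumes Z: "Z \<in> L"
  shows "cyclic_flat rank M Z"
  unfolding cyclic_flat_def
proof (intro conjI ballI disjCI)
  show "flat rank M Z" using flat_L[OF Z] .
  have ZM: "Z \<subseteq> M" using subset_ground[OF Z] .
  fix i assume i: "i \<in> Z" and "\<not> rank Z - rank (Z - {i}) < rank {i}"
  then have ge: "rank (Z - {i}) + \<mu> {i} \<le> r Z"
    using rank_eq_r[OF Z] rank_singleton ZM by auto
  obtain Y where Y: "Y \<in> L" "rank (Z - {i}) = r Y + \<mu> (Z - {i} - Y)" by (rule rank_attained)
  have "0 \<le> \<mu> {i}" using i ZM by (auto intro: measure_on_singleton_nonneg[OF measure])
  \<comment> \<open>If the minimizer \<open>Y\<close> contains \<open>i\<close>, deleting
    \<open>i\<close> does not lower the bound, so its full contribution must be zero. If not, the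
    comparison with \<open>Y\<close> is an equality, forcing \<open>Y = Z\<close> although
    \<open>i\<close> is in \<open>Z\<close>.\<close>
  have "\<mu> {i} = 0"
  proof (cases "i \<in> Y")
    case True
    then have "Z - {i} - Y = Z - Y" by blast
    then show ?thesis using ge Y r_le_add_measure(1)[OF Y(1) Z] \<open>0 \<le> \<mu> {i}\<close> by simp
  next
    case False
    have "\<mu> ((Z - {i} - Y) \<union> {i}) = \<mu> (Z - {i} - Y) + \<mu> {i}"
      using ZM i by (intro measure_on_Un[OF measure]) auto
    moreover have "(Z - {i} - Y) \<union> {i} = Z - Y" using i False by blast
    ultimately have "r Z = r Y + \<mu> (Z - Y)" using ge Y r_le_add_measure(1)[OF Y(1) Z] by simp
    then have "Y = Z" using r_le_add_measure(2)[OF Y(1) Z] by blast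
    then show ?thesis using i False by blast
  qed
  then show "rank {i} = 0" using rank_singleton i ZM by auto
qed

text \<open>A minimizer \<open>Z\<close> for \<open>C\<close> equals \<open>C\<close>. Adding a
  point of \<open>Z\<close> to \<open>C\<close> keeps the bound from \<open>Z\<close>, so flatness
  gives \<open>Z \<subseteq> C\<close>; a point of \<open>C - Z\<close> would contribute its full
  positive measure, so cyclicity gives \<open>C \<subseteq> Z\<close>.\<close>

lemma cyclic_flat_imp_L:
  assumes C: "cyclic_flat rank M C"
  shows "C \<in> L"
proof -
  have CM: "C \<subseteq> M" using C unfolding cyclic_flat_def flat_def by blast
  obtain Z where Z: "Z \<in> L" "rank C = r Z + \<mu> (C - Z)" by (rule rank_attained)
  have "x \<in> C" if x: "x \<in> Z" for x
  proof (rule ccontr)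
    assume "x \<notin> C"
    then have "rank C < rank (insert x C)"
      using C x subset_ground[OF Z(1)] flat_iff[OF polymatroid_rank] unfolding cyclic_flat_def by blast
    moreover have "insert x C - Z = C - Z" using x by blast
    ultimately show False using rank_le[OF Z(1), of "insert x C"] Z by simp
  qed
  moreover have "x \<in> Z" if x: "x \<in> C" for x
  proof (rule ccontr)
    assume nx: "x \<notin> Z"
    have "\<mu> ((C - {x} - Z) \<union> {x}) = \<mu> (C - {x} - Z) + \<mu> {x}"
      using CM x by (intro measure_on_Un[OF measure]) auto
    moreover have "(C - {x} - Z) \<union> {x} = C - Z" using x nx by blast
    ultimately have "rank (C - {x}) + \<mu> {x} \<le> rank C"
      using rank_le[OF Z(1), of "C - {x}"] Z by simp
    moreover have "rank {x} = \<mu> {x}" using rank_singleton x CM by blast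
    moreover have "rank {x} = 0 \<or> rank C - rank (C - {x}) < rank {x}"
      using C x unfolding cyclic_flat_def by blast
    moreover have "0 < \<mu> {x}" using \<mu>_pos_outside[OF Z(1), of x] x nx CM by blast
    ultimately show False by linarith
  qed
  ultimately have "C = Z" by blast
  with Z show ?thesis by simp
qed

lemma represents_rank: "represents rank M r L \<mu>"
  unfolding represents_def
  using polymatroid_rank cyclic_flat_L cyclic_flat_imp_L rank_eq_r rank_singleton by auto

end

theorem theorem4:
  fixes M :: "'a set" and L :: "'a set set" and r \<mu> :: "'a set \<Rightarrow> real"
  assumes "finite M"
    and "ranked_lattice M r L"
    and "measure_on M \<mu>"
  shows "((\<exists>f. represents f M r L \<mu>) \<longleftrightarrow> cyclic_flat_conditions M r L \<mu>) \<and>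
    (cyclic_flat_conditions M r L \<mu> \<longrightarrow>
       (\<forall>f g. represents f M r L \<mu> \<and> represents g M r L \<mu> \<longrightarrow> (\<forall>A\<subseteq>M. f A = g A)) \<and>
       (\<forall>f. represents f M r L \<mu> \<longrightarrow>
          ((\<forall>A\<subseteq>M. f A \<in> \<int>) \<longleftrightarrow> (\<forall>Z\<in>L. r Z \<in> \<int>) \<and> (\<forall>A\<subseteq>M. \<mu> A \<in> \<int>))))"
proof (intro conjI impI allI)
  show "(\<exists>f. represents f M r L \<mu>) \<longleftrightarrow> cyclic_flat_conditions M r L \<mu>"
  proof
    show "cyclic_flat_conditions M r L \<mu>" if "\<exists>f. represents f M r L \<mu>"
      using that represents_imp_conditions[OF assms(2,3)] by (elim exE)
    show "\<exists>f. represents f M r L \<mu>" if "cyclic_flat_conditions M r L \<mu>"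
      using cyclic_flat_axioms.represents_rank[OF cyclic_flat_axioms.intro[OF assms that]]
      by blast
  qed
  show "f A = g A" if "represents f M r L \<mu> \<and> represents g M r L \<mu>" "A \<subseteq> M" for f g A
    using represents_unique[OF conjunct1[OF that(1)] conjunct2[OF that(1)] assms(3) that(2)] .
qed (rule represents_integral_iff[OF _ assms(3)])

end
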